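(* Let $p>2$ and $p'=p/(p-1)$. Let $\mathcal V:\mathbb R\to\mathbb R$ be a $C^2$ function for which there are $A,B\in\mathbb R$ with $0<A<B$ and $E_*>0$ such that $\mathcal V(0)=\mathcal V(B)=E_*$, $\mathcal V'(0)=\mathcal V(A)=\mathcal V'(A)=0$, $\mathcal V''(A)>0$, and $0<\mathcal V(w)<E_*$ for all $w\in(0,A)\cup(A,B)$. Assume moreover that $$(w-A)\,\mathcal V'(w)>0\quad\text{for all } w\in(0,A)\cup(A,B).$$ For $E\in(0,E_* )$, let $T(E)$ be the minimal period of the positive periodic solutions with energy $E$ of $(|w'|^{p-2}w')'+\mathcal V'(w)=0$ that surround the equilibrium $(w,w')=(A,0)$. If $$|\mathcal V'(w)|^2-p'\,\mathcal V(w)\,\mathcal V''(w)>0\quad\text{for all } w\in(0,A)\cup(A,B),$$ then $E\mapsto T(E)$ is increasing on $(0,E_* )$.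
   Context: The energy $E=\frac1{p'}|w'|^p+\mathcal V(w)$ is constant along solutions of $(|w'|^{p-2}w')'+\mathcal V'(w)=0$. For $E\in(0,E_* )$, let $w_1(E)<w_2(E)$ be the two roots of $\mathcal V(w)=E$ such that $0<w_1(E)<A<w_2(E)<B$ and $\mathcal V(w)<E$ for all $w\in(w_1(E),w_2(E))$. The periodic solutions considered are those with energy $E$ oscillating between $w_1(E)$ and $w_2(E)$; their minimal period is $$T(E)=\frac{2}{(p')^{1/p}}\int_{w_1(E)}^{w_2(E)}\frac{dw}{(E-\mathcal V(w))^{1/p}}.$$ *)

theory Defs
  imports "HOL-Analysis.Analysis"
begin

definition conj_exp :: "real \<Rightarrow> real" where
  "conj_exp p = p / (p - 1)"

text \<open>
  Classical solutions on the whole real line: the function itself and its flux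
  \<open>|w'|^(p-2) w'\<close> are differentiable everywhere. At points where \<open>w'\<close> vanishes the flux is
  \<open>0\<close>, because \<open>0 powr a = 0\<close>.
\<close>

definition plap_solution :: "real \<Rightarrow> (real \<Rightarrow> real) \<Rightarrow> (real \<Rightarrow> real) \<Rightarrow> bool" where
  "plap_solution p V w \<longleftrightarrow>
     w differentiable_on UNIV \<and>
     (\<forall>t. ((\<lambda>s. \<bar>deriv w s\<bar> powr (p - 2) * deriv w s)
            has_real_derivative - deriv V (w t)) (at t))"

definition energy :: "real \<Rightarrow> (real \<Rightarrow> real) \<Rightarrow> (real \<Rightarrow> real) \<Rightarrow> real \<Rightarrow> real" where
  "energy p V w t = \<bar>deriv w t\<bar> powr p / conj_exp p + V (w t)"

definition turning_points ::
    "(real \<Rightarrow> real) \<Rightarrow> real \<Rightarrow> real \<Rightarrow> real \<Rightarrow> real \<Rightarrow> real \<Rightarrow> bool" where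
  "turning_points V A B E w1 w2 \<longleftrightarrow>
     0 < w1 \<and> w1 < A \<and> A < w2 \<and> w2 < B \<and>
     V w1 = E \<and> V w2 = E \<and> (\<forall>x\<in>{w1<..<w2}. V x < E)"

definition is_minimal_period :: "(real \<Rightarrow> real) \<Rightarrow> real \<Rightarrow> bool" where
  "is_minimal_period f T \<longleftrightarrow>
     0 < T \<and> (\<forall>t. f (t + T) = f t) \<and>
     (\<forall>S. 0 < S \<and> S < T \<longrightarrow> (\<exists>t. f (t + S) \<noteq> f t))"

text \<open>
  A positive solution of energy \<open>E\<close> surrounds \<open>(A, 0)\<close> when it oscillates between the two
  turning points on either side of \<open>A\<close>, that is, when its range is the closed interval they bound.
\<close>

definition oscillating_solution ::
    "real \<Rightarrow> (real \<Rightarrow> real) \<Rightarrow> real \<Rightarrow> real \<Rightarrow> real \<Rightarrow> (real \<Rightarrow> real) \<Rightarrow> bool" where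
  "oscillating_solution p V A B E w \<longleftrightarrow>
     plap_solution p V w \<and>
     (\<forall>t. 0 < w t) \<and>
     (\<forall>t. energy p V w t = E) \<and>
     (\<exists>w1 w2. turning_points V A B E w1 w2 \<and> range w = {w1..w2})"

text \<open>
  The common minimal period of these solutions. The description denotes a specific number only if
  such a periodic solution exists and all of them have the same minimal period.
\<close>

definition orbit_period ::
    "real \<Rightarrow> (real \<Rightarrow> real) \<Rightarrow> real \<Rightarrow> real \<Rightarrow> real \<Rightarrow> real" where
  "orbit_period p V A B E =
     (THE T. \<exists>w. oscillating_solution p V A B E w \<and> is_minimal_period w T)"

end

theory Submission
  imports Defs
begin

text \<open>
  On an orbit of energy \<open>E\<close> the speed is \<open>(p' (E - V w)) powr (1 / p)\<close>, so the travel time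
  from the left turning point, as a function of the position, is a primitive of its reciprocal. The
  travel time of any solution is a triangle wave in \<open>t\<close>; hence every solution has minimal period
  twice the travel time between the turning points, and inverting the travel time
  along a triangle wave produces a solution.

  For the monotonicity, split the travel time at \<open>A\<close>. On each branch substitute
  \<open>V w = E s\<close>: the integrand over \<open>0 < s < 1\<close> becomes
  \<open>V w powr (1 / p') / \<bar>V' w\<bar>\<close> times a kernel independent of \<open>E\<close>, and
  \<open>V powr (1 / p') / \<bar>V'\<bar>\<close> increases away from \<open>A\<close> exactly because
  \<open>V'\<^sup>2 - p' V V'' > 0\<close>.
\<close>

section \<open>Derivatives recovered as limits, and inverses of increasing functions\<close>

lemma has_real_derivative_from_limit:
  fixes f g :: "real \<Rightarrow> real"
  assumes cont: "isCont f a"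
    and deriv: "\<forall>\<^sub>F x in at a. (f has_real_derivative g x) (at x)"
    and lim: "(g \<longlongrightarrow> L) (at a)"
  shows "(f has_real_derivative L) (at a)"
proof -
  have "((\<lambda>x. (f x - f a) / (x - a)) \<longlongrightarrow> L) (at a)"
  proof (rule lhopital[where f' = g and g' = "\<lambda>_. 1"])
    show "((\<lambda>x. f x - f a) \<longlongrightarrow> 0) (at a)"
      using cont by (simp add: isCont_def LIM_zero)
    show "((\<lambda>x. x - a) \<longlongrightarrow> 0) (at a)"
      by (rule LIM_zero) simp
    show "\<forall>\<^sub>F x in at a. x - a \<noteq> 0"
      by (auto simp: eventually_at_filter)
    show "\<forall>\<^sub>F x in at a. ((\<lambda>x. f x - f a) has_real_derivative g x) (at x)"
      using deriv by eventually_elim (auto intro!: derivative_eq_intros)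
    show "\<forall>\<^sub>F x in at a. ((\<lambda>x. x - a) has_real_derivative 1) (at x)"
      by (intro always_eventually allI) (auto intro!: derivative_eq_intros)
  qed (use lim in auto)
  then show ?thesis
    by (simp add: has_field_derivative_iff)
qed

lemma strict_mono_on_deriv_pos:
  fixes f f' :: "real \<Rightarrow> real"
  assumes cont: "continuous_on {a..b} f"
    and deriv: "\<And>x. a < x \<Longrightarrow> x < b \<Longrightarrow> (f has_real_derivative f' x) (at x)"
    and pos: "\<And>x. a < x \<Longrightarrow> x < b \<Longrightarrow> 0 < f' x"
  shows "strict_mono_on {a..b} f"
proof (rule strict_mono_onI)
  fix x y assume xy: "x \<in> {a..b}" "y \<in> {a..b}" "x < y"
  have "continuous_on {x..y} f"
    using cont by (rule continuous_on_subset) (use xy in auto)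
  then show "f x < f y"
    using xy by (intro DERIV_pos_imp_increasing_open[OF \<open>x < y\<close>]) (auto intro!: deriv pos exI)
qed

text \<open>The derivative is required only inside the interval because it degenerates at the ends
  in both uses: the travel time has infinite slope at the turning points, and \<open>V'\<close>
  vanishes at \<open>A\<close>.\<close>

lemma increasing_inverse:
  fixes f f' :: "real \<Rightarrow> real"
  assumes "a < b"
    and cont: "continuous_on {a..b} f"
    and deriv: "\<And>x. a < x \<Longrightarrow> x < b \<Longrightarrow> (f has_real_derivative f' x) (at x)"
    and pos: "\<And>x. a < x \<Longrightarrow> x < b \<Longrightarrow> 0 < f' x"
  obtains g where
    "continuous_on {f a..f b} g" "strict_mono_on {f a..f b} g"
    "\<forall>x\<in>{a..b}. g (f x) = x"
    "\<forall>y\<in>{f a..f b}. g y \<in> {a..b} \<and> f (g y) = y"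
    "\<forall>y. f a < y \<longrightarrow> y < f b \<longrightarrow> a < g y \<and> g y < b \<and>
       (g has_real_derivative inverse (f' (g y))) (at y)"
proof -
  have mono: "strict_mono_on {a..b} f"
    using cont deriv pos by (rule strict_mono_on_deriv_pos)
  have inj: "inj_on f {a..b}"
    using mono by (rule strict_mono_on_imp_inj_on)
  have img: "f ` {a..b} = {f a..f b}"
  proof
    show "f ` {a..b} \<subseteq> {f a..f b}"
      using strict_mono_on_leD[OF mono, of a] strict_mono_on_leD[OF mono, of _ b] \<open>a < b\<close> by auto
    show "{f a..f b} \<subseteq> f ` {a..b}"
      using IVT'[of f a _ b] cont \<open>a < b\<close> by force
  qed
  define g where "g = the_inv_into {a..b} f"
  have gf: "g (f x) = x" if "x \<in> {a..b}" for x
    unfolding g_def using inj that by (rule the_inv_into_f_f)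
  have g: "g y \<in> {a..b} \<and> f (g y) = y" if "y \<in> {f a..f b}" for y
    using that gf unfolding img[symmetric] by auto
  have contg: "continuous_on {f a..f b} g"
    unfolding img[symmetric] using cont by (rule continuous_on_inv) (auto simp: gf)
  have monog: "strict_mono_on {f a..f b} g"
  proof (rule strict_mono_onI)
    fix x y assume "x \<in> {f a..f b}" "y \<in> {f a..f b}" "x < y"
    then show "g x < g y"
      using g[of x] g[of y] strict_mono_on_leD[OF mono, of "g y" "g x"] by (cases "g x < g y") auto
  qed
  have "a < g y \<and> g y < b \<and> (g has_real_derivative inverse (f' (g y))) (at y)"
    if y: "f a < y" "y < f b" for y
  proof -
    have "g y \<in> {a..b}" "f (g y) = y"
      using g y by auto
    then have *: "a < g y" "g y < b"
      using y by (force simp: less_le)+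
    have "(g has_real_derivative inverse (f' (g y))) (at y)"
    proof (rule DERIV_inverse_function[where f = f])
      show "(f has_real_derivative f' (g y)) (at (g y))" "f' (g y) \<noteq> 0"
        using deriv pos * by (auto simp: less_imp_neq[symmetric])
      show "isCont g y"
        using y by (intro continuous_on_interior[OF contg]) (simp add: interior_atLeastAtMost_real)
    qed (use y g in auto)
    with * show ?thesis by blast
  qed
  then show thesis
    using that contg monog gf g by blast
qed

section \<open>Triangle waves\<close>

text \<open>
  Abstracts an orbit: \<open>q\<close> is the travel time from the left turning point to the present
  position and \<open>s\<close> the flux, which changes sign at each turning point with the sign
  dictated by \<open>- V'\<close> there.
\<close>

definition bounces :: "real \<Rightarrow> (real \<Rightarrow> real) \<Rightarrow> (real \<Rightarrow> real) \<Rightarrow> bool" where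
  "bounces T q s \<longleftrightarrow> continuous_on UNIV q \<and> continuous_on UNIV s \<and>
     (\<forall>t. 0 \<le> q t \<and> q t \<le> T) \<and>
     (\<forall>t. s t = 0 \<longrightarrow> q t = 0 \<or> q t = T) \<and>
     (\<forall>t. s t \<noteq> 0 \<longrightarrow> (q has_real_derivative sgn (s t)) (at t)) \<and>
     (\<forall>t. q t = 0 \<longrightarrow> s t = 0 \<and> (\<exists>D>0. (s has_real_derivative D) (at t))) \<and>
     (\<forall>t. q t = T \<longrightarrow> s t = 0 \<and> (\<exists>D<0. (s has_real_derivative D) (at t)))"

text \<open>Measuring the travel time from the right turning point exchanges the roles of
  \<open>0\<close> and \<open>T\<close>, so a falling phase becomes a rising one.\<close>

lemma bounces_flip:
  assumes "bounces T q s"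
  shows "bounces T (\<lambda>t. T - q t) (\<lambda>t. - s t)"
proof -
  have "(s has_real_derivative D) (at t) \<Longrightarrow> ((\<lambda>t. - s t) has_real_derivative - D) (at t)" for D t
    by (auto intro!: derivative_eq_intros)
  moreover have "s t \<noteq> 0 \<longrightarrow> ((\<lambda>t. T - q t) has_real_derivative sgn (- s t)) (at t)" for t
    using assms unfolding bounces_def by (auto intro!: derivative_eq_intros simp: sgn_minus)
  ultimately show ?thesis
    using assms unfolding bounces_def
    by (auto intro!: continuous_intros) (metis neg_0_less_iff_less neg_less_0_iff_less)+
qed

text \<open>Time reversal carries statements about the future of a wave to its past. The two minus
  signs in \<open>- s (- t)\<close> cancel under differentiation, so the slopes of the flux at the
  turning points keep their signs.\<close>

lemma bounces_reverse:
  assumes "bounces T q s"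
  shows "bounces T (\<lambda>t. q (- t)) (\<lambda>t. - s (- t))"
proof -
  have neg: "(uminus has_real_derivative - 1) (at t)" for t :: real
    by (auto intro!: derivative_eq_intros)
  have "((\<lambda>t. - s (- t)) has_real_derivative D) (at t)"
    if "(s has_real_derivative D) (at (- t))" for D t
    using DERIV_minus[OF DERIV_chain2[of s D uminus t "- 1" UNIV]] that neg[of t] by simp
  moreover have "((\<lambda>t. q (- t)) has_real_derivative sgn (- s (- t))) (at t)" if "s (- t) \<noteq> 0" for t
  proof -
    have "(q has_real_derivative sgn (s (- t))) (at (- t))"
      using assms that unfolding bounces_def by blast
    then show ?thesis
      using DERIV_chain2[of q "sgn (s (- t))" uminus t "- 1" UNIV] neg[of t]
      by (simp add: sgn_minus)
  qed
  moreover have "continuous_on UNIV (\<lambda>t. q (- t))" "continuous_on UNIV (\<lambda>t. s (- t))"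
    using assms unfolding bounces_def
    by (auto intro!: continuous_on_compose2[of UNIV q] continuous_on_compose2[of UNIV s] continuous_intros)
  ultimately show ?thesis
    using assms unfolding bounces_def by (auto intro!: continuous_intros) blast+
qed

text \<open>At \<open>t0\<close> the flux vanishes with positive slope, so it is positive just
  afterwards, and while it stays positive \<open>q\<close> has slope \<open>1\<close>. A first zero
  \<open>z\<close> of the flux before \<open>t0 + T\<close> would give \<open>q z = z - t0\<close>
  strictly between \<open>0\<close> and \<open>T\<close>, which a zero of the flux excludes.\<close>

lemma bounces_rise:
  assumes b: "bounces T q s" and t0: "q t0 = 0" and x: "0 \<le> x" "x \<le> T"
  shows "q (t0 + x) = x"
proof -
  obtain d where d: "0 < d" "\<And>h. 0 < h \<Longrightarrow> h < d \<Longrightarrow> 0 < s (t0 + h)"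
    using b t0 DERIV_pos_inc_right[of s _ t0] unfolding bounces_def by (metis UNIV_I)
  have free: "q t = t - t0" if t: "t0 < t" and nz: "\<And>r. t0 < r \<Longrightarrow> r < t \<Longrightarrow> s r \<noteq> 0" for t
  proof -
    have pos: "0 < s r" if r: "t0 < r" "r < t" for r
    proof (rule ccontr)
      assume "\<not> 0 < s r"
      define r' where "r' = t0 + min (d / 2) ((r - t0) / 2)"
      have r': "t0 < r'" "r' < r" "0 < s r'"
        using d(1) d(2)[of "min (d / 2) ((r - t0) / 2)"] r by (auto simp: r'_def min_def field_simps)
      then obtain z where "r' \<le> z" "z \<le> r" "s z = 0"
        using IVT2'[of s r 0 r'] \<open>\<not> 0 < s r\<close> b
        by (force simp: bounces_def intro: continuous_on_subset)
      then show False
        using nz[of z] r r' by auto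
    qed
    have "q t - t = q t0 - t0"
    proof (rule DERIV_isconst_end[OF t])
      show "continuous_on {t0..t} (\<lambda>t. q t - t)"
        using b unfolding bounces_def by (intro continuous_intros) (auto intro: continuous_on_subset)
      show "((\<lambda>t. q t - t) has_real_derivative 0) (at r)" if r: "t0 < r" "r < t" for r
      proof -
        have "(q has_real_derivative 1) (at r)"
          using pos[OF r] b unfolding bounces_def by (metis less_irrefl sgn_pos)
        then show ?thesis
          by (auto intro!: derivative_eq_intros)
      qed
    qed
    with t0 show ?thesis by simp
  qed
  show ?thesis
  proof (cases "x = 0")
    case False
    have "s r \<noteq> 0" if r: "t0 < r" "r < t0 + x" for r
    proof
      assume "s r = 0"
      \<comment> \<open>The window starts after \<open>t0\<close>, where \<open>s\<close> vanishes
        too, but no later than \<open>r\<close>. Hence \<open>Z\<close> is compact and nonempty, and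
        its least element is the first zero after \<open>t0\<close>.\<close>
      define Z where "Z = {t0 + min (d / 2) (r - t0)..r} \<inter> {z. s z = 0}"
      have "compact Z"
        unfolding Z_def
        using b unfolding bounces_def
        by (intro compact_Int_closed closed_Collect_eq) auto
      moreover have "r \<in> Z"
        using \<open>s r = 0\<close> by (auto simp: Z_def)
      ultimately obtain z where z: "z \<in> Z" "\<And>y. y \<in> Z \<Longrightarrow> z \<le> y"
        using compact_attains_inf[of Z] by blast
      have "t0 < z"
        using z(1) r d by (auto simp: Z_def min_def split: if_splits)
      moreover have "s y \<noteq> 0" if y: "t0 < y" "y < z" for y
      proof (cases "y - t0 < d")
        case True
        then show ?thesis using d(2)[of "y - t0"] y by auto
      next
        case False
        then show ?thesis using z(1) z(2)[of y] y d r by (auto simp: Z_def min_def split: if_splits)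
      qed
      ultimately have "q z = z - t0"
        by (rule free)
      moreover have "q z = 0 \<or> q z = T"
        using z(1) b by (auto simp: Z_def bounces_def)
      ultimately show False
        using \<open>t0 < z\<close> z(1) r x by (auto simp: Z_def)
    qed
    then show ?thesis
      using free[of "t0 + x"] x False by auto
  qed (use t0 in simp)
qed

lemma bounces_fall:
  assumes b: "bounces T q s" and "q t0 = T" "0 \<le> x" "x \<le> T"
  shows "q (t0 + x) = T - x"
  using bounces_rise[OF bounces_flip[OF b], of t0 x] assms by simp

text \<open>From every zero the wave rises to \<open>T\<close> and is back at \<open>0\<close> after
  \<open>2 * T\<close>. Repeating this in both time directions gives equally spaced zeros, and the
  explicit shape between them yields both claims.\<close>

lemma bounces_period:
  assumes b: "bounces T q s" and T: "0 < T" and t0: "q t0 = 0"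
  shows "q (t + 2 * T) = q t"
    and "0 < r \<Longrightarrow> r < 2 * T \<Longrightarrow> q (t0 + r) \<noteq> 0"
proof -
  have wave: "q (t1 + 2 * T) = 0"
    "\<And>x. 0 \<le> x \<Longrightarrow> x \<le> 2 * T \<Longrightarrow> q (t1 + x) = (if x \<le> T then x else 2 * T - x)"
    if b: "bounces T q s" and t1: "q t1 = 0" for q s t1
  proof -
    have top: "q (t1 + T) = T"
      using bounces_rise[OF b t1, of T] T by simp
    show *: "q (t1 + x) = (if x \<le> T then x else 2 * T - x)" if "0 \<le> x" "x \<le> 2 * T" for x
      using bounces_rise[OF b t1, of x] bounces_fall[OF b top, of "x - T"] that by auto
    show "q (t1 + 2 * T) = 0"
      using *[of "2 * T"] T by simp
  qed
  have up: "q (t0 + real n * (2 * T)) = 0" for n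
  proof (induction n)
    case (Suc n)
    then show ?case
      using wave(1)[OF b Suc] by (simp add: algebra_simps)
  qed (use t0 in simp)
  have down: "q (t0 - real n * (2 * T)) = 0" for n
  proof (induction n)
    case (Suc n)
    then show ?case
      using wave(1)[OF bounces_reverse[OF b], of "- (t0 - real n * (2 * T))"]
      by (simp add: algebra_simps)
  qed (use t0 in simp)
  have zeros: "q (t0 + of_int k * (2 * T)) = 0" for k :: int
    using up[of "nat k"] down[of "nat (- k)"] by (cases "0 \<le> k") auto
  \<comment> \<open>\<open>k\<close> numbers the period window containing \<open>t\<close>, and
    \<open>x\<close> is the offset in it; \<open>t + 2 * T\<close> has the same offset in window
    \<open>k + 1\<close>.\<close>
  define k where "k = \<lfloor>(t - t0) / (2 * T)\<rfloor>"
  define x where "x = t - (t0 + of_int k * (2 * T))"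
  have "of_int k \<le> (t - t0) / (2 * T)" "(t - t0) / (2 * T) < of_int k + 1"
    unfolding k_def by linarith+
  then have x: "0 \<le> x" "x \<le> 2 * T"
    using T by (auto simp: x_def field_simps)
  have "q t = q (t + 2 * T)"
    using wave(2)[OF b zeros x, of k] wave(2)[OF b zeros x, of "k + 1"]
    by (simp add: x_def algebra_simps)
  then show "q (t + 2 * T) = q t" by simp
  show "q (t0 + r) \<noteq> 0" if "0 < r" "r < 2 * T"
    using wave(2)[OF b t0, of r] that by auto
qed

section \<open>Locally constant signs and isolated zeros of the sine\<close>

lemma has_real_derivative_sgn_comp:
  fixes f :: "real \<Rightarrow> real"
  assumes "isCont f t" "f t \<noteq> 0"
  shows "((\<lambda>s. sgn (f s)) has_real_derivative 0) (at t)"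
proof -
  have lim: "(f \<longlongrightarrow> f t) (nhds t)"
    using assms(1) by (simp add: isCont_def tendsto_at_iff_tendsto_nhds)
  have "\<forall>\<^sub>F s in nhds t. sgn (f s) = sgn (f t)"
  proof (cases "0 < f t")
    case True
    then have "\<forall>\<^sub>F s in nhds t. 0 < f s"
      by (rule order_tendstoD(1)[OF lim])
    then show ?thesis
      by eventually_elim (use True in simp)
  next
    case False
    with assms have "f t < 0" by simp
    then have "\<forall>\<^sub>F s in nhds t. f s < 0"
      by (rule order_tendstoD(2)[OF lim])
    then show ?thesis
      by eventually_elim (use \<open>f t < 0\<close> in simp)
  qed
  then show ?thesis
    using DERIV_cong_ev[OF refl, of "\<lambda>s. sgn (f s)" "\<lambda>_. sgn (f t)" t 0 0] by simp
qed

text \<open>The zeros in \<open>s\<close> are the integer multiples of \<open>T\<close>, so none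
  lies within distance \<open>T\<close> of another; at all other points continuity is
  enough.\<close>

lemma eventually_sin_nonzero:
  assumes "0 < T"
  shows "\<forall>\<^sub>F s in at t. sin (pi * s / T) \<noteq> 0"
proof (cases "sin (pi * t / T) = 0")
  case True
  then obtain i :: int where i: "t = of_int i * T"
    using assms by (auto simp: sin_zero_iff_int2 field_simps)
  have "sin (pi * s / T) \<noteq> 0" if "s \<noteq> t" "dist s t < T" for s
  proof
    assume "sin (pi * s / T) = 0"
    then obtain j :: int where j: "s = of_int j * T"
      using assms by (auto simp: sin_zero_iff_int2 field_simps)
    have "\<bar>of_int (j - i)\<bar> * T < 1 * T"
      using that(2) assms i j by (simp add: dist_real_def abs_mult[symmetric] left_diff_distrib abs_mult_pos)
    then have "\<bar>j - i\<bar> < 1"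
      using assms by (simp only: mult_less_cancel_right_pos)
    then show False
      using that(1) i j by simp
  qed
  then show ?thesis
    using assms unfolding eventually_at by blast
next
  case False
  have "((\<lambda>s. sin (pi * s / T)) \<longlongrightarrow> sin (pi * t / T)) (at t)"
    using assms by (intro tendsto_intros) auto
  then show ?thesis
    using False by (rule tendsto_imp_eventually_ne)
qed

section \<open>Oscillations in a potential well\<close>

lemma conj_exp_pos: "1 < p \<Longrightarrow> 0 < conj_exp p"
  by (simp add: conj_exp_def)

lemma inverse_conj_exp: "1 < p \<Longrightarrow> 1 / conj_exp p = 1 - 1 / p"
  by (simp add: conj_exp_def field_simps)

text \<open>The strict signs of \<open>V'\<close> at \<open>a\<close> and \<open>b\<close> say that
  the turning points are not equilibria. They make the travel time finite and let the flux cross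
  zero there with nonzero slope.\<close>

locale potential_well =
  fixes p E a b :: real and V :: "real \<Rightarrow> real"
  assumes p: "1 < p"
    and ab: "a < b"
    and V_diff: "V differentiable_on UNIV"
    and cont_V': "continuous_on UNIV (deriv V)"
    and V_ends: "V a = E" "V b = E"
    and V_less: "\<And>x. a < x \<Longrightarrow> x < b \<Longrightarrow> V x < E"
    and V'_ends: "deriv V a < 0" "0 < deriv V b"
begin

lemma V_deriv: "(V has_real_derivative deriv V x) (at x)"
  using V_diff by (simp add: differentiable_on_def DERIV_deriv_iff_real_differentiable)

lemma cont_V [continuous_intros]: "continuous_on S g \<Longrightarrow> continuous_on S (\<lambda>x. V (g x))"
  using continuous_on_compose2[OF differentiable_imp_continuous_on[OF V_diff]] by simp

definition gap :: "real \<Rightarrow> real" where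
  "gap x = conj_exp p * (E - V x)"

definition speed :: "real \<Rightarrow> real" where
  "speed x = gap x powr (1 / p)"

lemma gap_ends [simp]: "gap a = 0" "gap b = 0"
  by (simp_all add: gap_def V_ends)

lemma gap_pos: "a < x \<Longrightarrow> x < b \<Longrightarrow> 0 < gap x"
  using V_less[of x] conj_exp_pos[OF p] by (simp add: gap_def)

lemma gap_nonneg: "x \<in> {a..b} \<Longrightarrow> 0 \<le> gap x"
  using gap_pos[of x] by (cases "x = a"; cases "x = b") auto

lemma gap_eq_0_iff: "x \<in> {a..b} \<Longrightarrow> gap x = 0 \<longleftrightarrow> x = a \<or> x = b"
  using gap_pos[of x] by (cases "x = a"; cases "x = b") auto

lemma cont_gap [continuous_intros]: "continuous_on S g \<Longrightarrow> continuous_on S (\<lambda>x. gap (g x))"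
  unfolding gap_def by (intro continuous_intros)

lemma gap_deriv: "(gap has_real_derivative - conj_exp p * deriv V x) (at x)"
proof -
  have "((\<lambda>x. conj_exp p * (E - V x)) has_real_derivative conj_exp p * (0 - deriv V x)) (at x)"
    by (intro DERIV_cmult DERIV_diff DERIV_const V_deriv)
  then show ?thesis
    by (simp add: gap_def[abs_def])
qed

lemma speed_pos: "a < x \<Longrightarrow> x < b \<Longrightarrow> 0 < speed x"
  using gap_pos[of x] by (simp add: speed_def)

lemma slowness_pos: "a < x \<Longrightarrow> x < b \<Longrightarrow> 0 < 1 / speed x"
  using speed_pos[of x] by simp

lemma speed_neq_0: "a < x \<Longrightarrow> x < b \<Longrightarrow> speed x \<noteq> 0"
  using speed_pos[of x] by simp

lemma cont_speed [continuous_intros]: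
  assumes "continuous_on S g" "g ` S \<subseteq> {a..b}"
  shows "continuous_on S (\<lambda>x. speed (g x))"
  unfolding speed_def using assms p
  by (intro continuous_on_powr' continuous_intros) (auto intro!: gap_nonneg)

text \<open>
  \<open>gap powr (1 / conj_exp p)\<close> is a primitive of \<open>- V' / speed\<close>; since \<open>V'\<close> does not vanish at
  the turning points, this makes the improper integral of \<open>1 / speed\<close> converge there.
\<close>

lemma gap_powr_deriv:
  assumes "a < x" "x < b"
  shows "((\<lambda>x. gap x powr (1 / conj_exp p)) has_real_derivative - deriv V x / speed x) (at x)"
proof -
  have "((\<lambda>x. gap x powr (1 / conj_exp p)) has_real_derivative
      1 / conj_exp p * gap x powr (1 / conj_exp p - 1) * (- conj_exp p * deriv V x)) (at x)"
    by (rule DERIV_chain2[where f = "\<lambda>z. z powr (1 / conj_exp p)" and g = gap,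
          OF has_real_derivative_powr[OF gap_pos[OF assms]] gap_deriv])
  moreover have "gap x powr (1 / conj_exp p - 1) = 1 / speed x"
    using p by (simp add: inverse_conj_exp speed_def powr_minus_divide)
  ultimately show ?thesis
    using conj_exp_pos[OF p] by simp
qed

text \<open>Comparison: where \<open>V'\<close> has the constant sign \<open>e\<close> and size at
  least \<open>m\<close>, \<open>1 / speed\<close> is at most \<open>e V' / (m speed)\<close>, which
  has a primitive continuous up to the turning points.\<close>

lemma slowness_integrable_piece:
  assumes c: "a \<le> c" "c < d" "d \<le> b" and e: "e = 1 \<or> e = -1" and "0 < m"
    and m: "\<And>x. x \<in> {c..d} \<Longrightarrow> m \<le> e * deriv V x"
  shows "(\<lambda>x. 1 / speed x) integrable_on {c..d}"
proof -
  have "((\<lambda>x. - deriv V x / speed x) has_integral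
      (gap d powr (1 / conj_exp p) - gap c powr (1 / conj_exp p))) {c..d}"
  proof (rule fundamental_theorem_of_calculus_interior)
    show "continuous_on {c..d} (\<lambda>x. gap x powr (1 / conj_exp p))"
      using c conj_exp_pos[OF p]
      by (intro continuous_on_powr' continuous_intros) (auto intro!: gap_nonneg)
    show "((\<lambda>x. gap x powr (1 / conj_exp p)) has_vector_derivative - deriv V x / speed x) (at x)"
      if "x \<in> {c<..<d}" for x
      using gap_powr_deriv[of x] that c
      by (simp add: has_real_derivative_iff_has_vector_derivative)
  qed (use c in simp)
  then have dom: "(\<lambda>x. - e / m * (- deriv V x / speed x)) integrable_on {c..d}"
    by (intro integrable_on_mult_right) (auto simp: integrable_on_def)
  have "continuous_on UNIV gap"
    using cont_gap[of UNIV "\<lambda>x. x"] by simp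
  then have [measurable]: "gap \<in> borel_measurable borel"
    by (rule borel_measurable_continuous_onI)
  have "(\<lambda>x. 1 / speed x) \<in> borel_measurable lborel"
    unfolding speed_def by measurable
  then have meas: "(\<lambda>x. 1 / speed x) \<in> borel_measurable (lebesgue_on {c..d})"
    by (intro measurable_restrict_space1 measurable_completion)
  \<comment> \<open>If \<open>speed x = 0\<close>, both sides are \<open>0\<close> by the convention
    on division by zero, so turning points satisfy the bound as well.\<close>
  have bound: "\<bar>1 / speed x\<bar> \<le> - e / m * (- deriv V x / speed x)" if "x \<in> {c..d}" for x
  proof -
    have "0 \<le> speed x"
      by (simp add: speed_def)
    then show ?thesis
      using m[OF that] \<open>0 < m\<close> by (cases "speed x = 0") (auto simp: field_simps)
  qed
  show ?thesis
    by (rule measurable_bounded_by_integrable_imp_integrable_real[OF meas dom bound]) auto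
qed

text \<open>Near each end \<open>V'\<close> keeps its sign by continuity and the comparison applies;
  on the compact middle piece the integrand is continuous.\<close>

lemma slowness_integrable: "(\<lambda>x. 1 / speed x) integrable_on {a..b}"
proof -
  have cont': "isCont (deriv V) x" for x
    using cont_V' by (simp add: continuous_on_eq_continuous_at)
  obtain d1 where d1: "0 < d1" "\<And>x. \<bar>x - a\<bar> < d1 \<Longrightarrow> \<bar>deriv V x - deriv V a\<bar> < - deriv V a / 2"
    using cont'[of a] V'_ends unfolding continuous_at_eps_delta dist_real_def
    by (metis half_gt_zero neg_0_less_iff_less)
  obtain d2 where d2: "0 < d2" "\<And>x. \<bar>x - b\<bar> < d2 \<Longrightarrow> \<bar>deriv V x - deriv V b\<bar> < deriv V b / 2"
    using cont'[of b] V'_ends unfolding continuous_at_eps_delta dist_real_def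
    by (metis half_gt_zero)
  define c where "c = a + min (d1 / 2) ((b - a) / 3)"
  define d where "d = b - min (d2 / 2) ((b - a) / 3)"
  have c: "a < c" "c - a < d1" and d: "d < b" "b - d < d2" and cd: "c < d"
    using d1(1) d2(1) ab by (auto simp: c_def d_def min_def field_simps)
  have "(\<lambda>x. 1 / speed x) integrable_on {a..c}"
  proof (rule slowness_integrable_piece[where e = "-1"])
    show "- deriv V a / 2 \<le> -1 * deriv V x" if "x \<in> {a..c}" for x
      using d1(2)[of x] that c by (auto simp: abs_less_iff)
  qed (use c d cd V'_ends in auto)
  moreover have "(\<lambda>x. 1 / speed x) integrable_on {d..b}"
  proof (rule slowness_integrable_piece[where e = 1])
    show "deriv V b / 2 \<le> 1 * deriv V x" if "x \<in> {d..b}" for x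
    proof -
      have "\<bar>x - b\<bar> < d2"
        using that d by auto
      from d2(2)[OF this] show ?thesis by linarith
    qed
  qed (use c d cd V'_ends in auto)
  moreover have "(\<lambda>x. 1 / speed x) integrable_on {c..d}"
    using c d
    by (intro integrable_continuous_real continuous_intros) (use speed_neq_0 in force)+
  ultimately show ?thesis
    using c d cd Henstock_Kurzweil_Integration.integrable_combine[where a = a and c = c and b = d]
      Henstock_Kurzweil_Integration.integrable_combine[where a = a and c = d and b = b] by auto
qed

section \<open>The travel time as a function of the position\<close>

definition travel :: "real \<Rightarrow> real" where
  "travel x = integral {a..x} (\<lambda>x. 1 / speed x)"

lemma travel_a [simp]: "travel a = 0"
  by (simp add: travel_def)

lemma cont_travel: "continuous_on {a..b} travel"
  unfolding travel_def using slowness_integrable by (rule indefinite_integral_continuous_1)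

lemma travel_deriv:
  assumes "a < x" "x < b"
  shows "(travel has_real_derivative 1 / speed x) (at x)"
proof -
  have "continuous_on {a<..<b} (\<lambda>x. 1 / speed x)"
    by (intro continuous_intros) (use speed_neq_0 in force)+
  then have "isCont (\<lambda>x. 1 / speed x) x"
    using assms by (simp add: continuous_on_eq_continuous_at)
  then have "(travel has_vector_derivative 1 / speed x) (at x within {a..b} - {})"
    unfolding travel_def using assms slowness_integrable
    by (intro integral_has_vector_derivative_continuous_at)
      (auto intro: continuous_at_imp_continuous_at_within)
  moreover have "at x within {a..b} = at x"
    using assms by (simp add: at_within_Icc_at)
  ultimately show ?thesis
    by (simp add: has_real_derivative_iff_has_vector_derivative)
qed

lemma travel_mono: "strict_mono_on {a..b} travel"
  using cont_travel travel_deriv slowness_pos by (rule strict_mono_on_deriv_pos)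

lemma travel_b_pos: "0 < travel b"
  using strict_mono_onD[OF travel_mono, of a b] ab by simp

section \<open>Periodicity of all solutions in the well\<close>

lemma abs_deriv_eq_speed:
  assumes "energy p V w t = E"
  shows "\<bar>deriv w t\<bar> = speed (w t)"
proof -
  have "gap (w t) = \<bar>deriv w t\<bar> powr p"
    using assms conj_exp_pos[OF p] unfolding energy_def gap_def by (simp add: field_simps)
  then show ?thesis
    using p by (simp add: speed_def powr_powr)
qed

lemma travel_range: "x \<in> {a..b} \<Longrightarrow> travel x \<in> {0..travel b}"
  using strict_mono_on_leD[OF travel_mono, of a x] strict_mono_on_leD[OF travel_mono, of x b] by auto

lemma travel_inj: "inj_on travel {a..b}"
  using travel_mono by (rule strict_mono_on_imp_inj_on)

text \<open>Energy conservation gives \<open>\<bar>w'\<bar> = speed w\<close>, so the travel time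
  changes at rate \<open>w' / speed w\<close>, the sign of the flux. At a turning point the equation
  makes \<open>- V'\<close> the slope of the flux, positive at \<open>a\<close> and negative at
  \<open>b\<close>.\<close>

lemma solution_bounces:
  assumes sol: "plap_solution p V w" and en: "\<And>t. energy p V w t = E" and rng: "\<And>t. w t \<in> {a..b}"
  shows "bounces (travel b) (\<lambda>t. travel (w t)) (\<lambda>t. \<bar>deriv w t\<bar> powr (p - 2) * deriv w t)"
proof -
  let ?s = "\<lambda>t. \<bar>deriv w t\<bar> powr (p - 2) * deriv w t"
  have dw: "(w has_real_derivative deriv w t) (at t)" for t
    using sol by (simp add: plap_solution_def differentiable_on_def DERIV_deriv_iff_real_differentiable)
  have ds: "(?s has_real_derivative - deriv V (w t)) (at t)" for t
    using sol by (simp add: plap_solution_def)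
  have s0: "?s t = 0 \<longleftrightarrow> w t = a \<or> w t = b" for t
    using abs_deriv_eq_speed[OF en, of t] gap_eq_0_iff[OF rng, of t]
    by (auto simp: speed_def)
  have qa: "travel (w t) = 0 \<longleftrightarrow> w t = a" for t
    using inj_on_eq_iff[OF travel_inj rng, of a t] ab by auto
  have qb: "travel (w t) = travel b \<longleftrightarrow> w t = b" for t
    using inj_on_eq_iff[OF travel_inj rng, of b t] ab by auto
  have "((\<lambda>t. travel (w t)) has_real_derivative sgn (?s t)) (at t)" if "?s t \<noteq> 0" for t
  proof -
    have w: "a < w t" "w t < b"
      using that s0[of t] rng[of t] by auto
    have "sgn (?s t) = sgn (deriv w t)"
      using that by (auto simp: sgn_mult)
    also have "\<dots> = 1 / speed (w t) * deriv w t"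
      using abs_deriv_eq_speed[OF en, of t] by (simp add: real_sgn_eq)
    finally show ?thesis
      using DERIV_chain2[OF travel_deriv[OF w] dw] by simp
  qed
  moreover have "continuous_on UNIV (\<lambda>t. travel (w t))"
    using dw rng
    by (intro continuous_on_compose2[OF cont_travel] continuous_at_imp_continuous_on ballI)
      (auto intro: DERIV_isCont)
  moreover have "continuous_on UNIV ?s"
    using ds by (intro continuous_at_imp_continuous_on ballI) (rule DERIV_isCont)
  moreover have "\<exists>D>0. (?s has_real_derivative D) (at t)" if "w t = a" for t
    using ds[of t] that V'_ends by (intro exI[of _ "- deriv V a"]) auto
  moreover have "\<exists>D<0. (?s has_real_derivative D) (at t)" if "w t = b" for t
    using ds[of t] that V'_ends by (intro exI[of _ "- deriv V b"]) auto
  ultimately show ?thesis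
    using travel_range[OF rng] s0 unfolding bounces_def qa qb by auto
qed

text \<open>Injectivity of \<open>travel\<close> transfers the period from the triangle wave to
  \<open>w\<close>. Minimality is seen at a time when \<open>w\<close> is at \<open>a\<close>, since
  the wave does not return to \<open>0\<close> before a full period.\<close>

lemma solution_minimal_period:
  assumes sol: "plap_solution p V w" and en: "\<And>t. energy p V w t = E" and rng: "range w = {a..b}"
  shows "is_minimal_period w (2 * travel b)"
proof -
  have w: "w t \<in> {a..b}" for t
    using rng by blast
  have "a \<in> range w"
    using rng ab by simp
  then obtain t0 where t0: "travel (w t0) = 0"
    by (metis imageE travel_a)
  note per = bounces_period[OF solution_bounces[OF sol en w] travel_b_pos t0]
  have "w (t + 2 * travel b) = w t" for t
    using per(1)[of t] w inj_onD[OF travel_inj] by blast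
  moreover have "w (t0 + S) \<noteq> w t0" if "0 < S" "S < 2 * travel b" for S
    using per(2)[OF that] t0 by metis
  ultimately show ?thesis
    using travel_b_pos unfolding is_minimal_period_def by (auto simp del: add_diff_eq)
qed

text \<open>
  The solution follows the inverse \<open>u\<close> of the travel time along a triangle wave of slope
  \<open>1\<close>, written as a rescaled \<open>arccos (cos t)\<close> so that it is smooth exactly where the sine
  does not vanish. At the zeros of the sine the derivatives are recovered as limits.
\<close>

lemma solution_exists:
  obtains w where "plap_solution p V w" "\<And>t. energy p V w t = E" "range w = {a..b}"
proof -
  define T where "T = travel b"
  have T: "0 < T"
    using travel_b_pos by (simp add: T_def)
  obtain u where u0: "continuous_on {0..T} u" "strict_mono_on {0..T} u"
    "\<forall>x\<in>{a..b}. u (travel x) = x"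
    "\<forall>y\<in>{0..T}. u y \<in> {a..b} \<and> travel (u y) = y"
    "\<forall>y. 0 < y \<longrightarrow> y < T \<longrightarrow> a < u y \<and> u y < b \<and>
       (u has_real_derivative inverse (1 / speed (u y))) (at y)"
    by (rule increasing_inverse[OF ab cont_travel travel_deriv slowness_pos, unfolded travel_a, folded T_def])
  note u = u0[rule_format]
  \<comment> \<open>\<open>d\<close> is the triangle wave and \<open>S\<close> its slope, with value
    \<open>0\<close> at the kinks. \<open>\<Phi>\<close> is the flux in closed form, since
    \<open>speed powr (p - 1)\<close> equals \<open>gap powr (1 / conj_exp p)\<close>.\<close>
  define d where "d t = T / pi * arccos (cos (pi * t / T))" for t
  define S where "S t = sgn (sin (pi * t / T))" for t
  define w where "w t = u (d t)" for t
  define \<Phi> where "\<Phi> t = S t * gap (w t) powr (1 / conj_exp p)" for t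
  have d_range: "d t \<in> {0..T}" for t
    using T arccos_lbound[of "cos (pi * t / T)"] arccos_ubound[of "cos (pi * t / T)"]
    by (auto simp: d_def field_simps)
  have w_range: "w t \<in> {a..b}" for t
    using u(4)[OF d_range] by (simp add: w_def)
  have cont_d: "continuous_on UNIV d"
    unfolding d_def using T by (intro continuous_intros) auto
  have cont_w: "continuous_on UNIV w"
    unfolding w_def using d_range by (intro continuous_on_compose2[OF u(1) cont_d]) auto
  have S0: "w t = a \<or> w t = b" "S t = 0" if "sin (pi * t / T) = 0" for t
  proof -
    have "cos (pi * t / T) = 1 \<or> cos (pi * t / T) = -1"
      using sin_cos_squared_add[of "pi * t / T"] that by (simp add: power2_eq_1_iff)
    then have "d t = travel a \<or> d t = travel b"
      using T by (auto simp: d_def T_def)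
    then show "w t = a \<or> w t = b"
      using u(3) ab by (auto simp: w_def simp del: travel_a)
    show "S t = 0"
      using that by (simp add: S_def)
  qed
  have smooth: "a < w t" "w t < b" "(w has_real_derivative S t * speed (w t)) (at t)"
    "(\<Phi> has_real_derivative - deriv V (w t)) (at t)"
    if nz: "sin (pi * t / T) \<noteq> 0" for t
  proof -
    define x where "x = pi * t / T"
    have "(sin x)\<^sup>2 = 1 - (cos x)\<^sup>2" "sin x \<noteq> 0"
      using nz by (auto simp: sin_squared_eq x_def)
    then have "(cos x)\<^sup>2 < 1\<^sup>2" and sq: "sqrt (1 - (cos x)\<^sup>2) = \<bar>sin x\<bar>"
      by (metis diff_gt_0_iff_gt one_power2 zero_less_power2) (metis real_sqrt_abs \<open>(sin x)\<^sup>2 = 1 - (cos x)\<^sup>2\<close>)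
    then have c: "- 1 < cos x" "cos x < 1"
      by (auto simp: abs_square_less_1 abs_less_iff)
    have "0 < arccos (cos x)" "arccos (cos x) < pi"
      using arccos_lt_bounded[OF c] by auto
    then have d: "0 < d t" "d t < T"
      using T by (auto simp: d_def x_def field_simps)
    have "(d has_real_derivative T / pi * (inverse (- sqrt (1 - (cos x)\<^sup>2)) * (- sin x * (pi / T)))) (at t)"
      unfolding d_def using c T unfolding x_def
      by (auto intro!: derivative_eq_intros)
    also have "T / pi * (inverse (- sqrt (1 - (cos x)\<^sup>2)) * (- sin x * (pi / T))) = S t"
    proof -
      have "S t = sgn (sin x)"
        by (simp add: S_def x_def)
      then show ?thesis
        using T \<open>sin x \<noteq> 0\<close> by (simp add: real_sgn_eq sq field_simps)
    qed
    finally have dd: "(d has_real_derivative S t) (at t)" .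
    show w: "a < w t" "w t < b"
      using u(5)[OF d] by (auto simp: w_def)
    have "(u has_real_derivative speed (w t)) (at (d t))"
      using u(5)[OF d] by (simp add: w_def)
    from DERIV_chain2[OF this dd] show dw: "(w has_real_derivative S t * speed (w t)) (at t)"
      by (simp add: w_def[abs_def] mult.commute)
    have dg: "((\<lambda>t. gap (w t) powr (1 / conj_exp p)) has_real_derivative - deriv V (w t) * S t) (at t)"
      using DERIV_chain2[OF gap_powr_deriv[OF w] dw] speed_pos[OF w] by simp
    have dS: "(S has_real_derivative 0) (at t)"
      unfolding S_def using nz T by (intro has_real_derivative_sgn_comp continuous_intros) auto
    \<comment> \<open>The direction of travel enters twice, once through \<open>w'\<close> and once
      through the factor \<open>S\<close> of \<open>\<Phi>\<close>, and cancels.\<close>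
    have "S t * S t = 1"
      using nz by (simp add: S_def real_sgn_eq)
    with DERIV_mult[OF dS dg] show "(\<Phi> has_real_derivative - deriv V (w t)) (at t)"
      by (simp add: \<Phi>_def[abs_def] mult.assoc)
  qed
  have cont_comp: "isCont (\<lambda>s. h (w s)) t" if "continuous_on {a..b} h" for h :: "real \<Rightarrow> real" and t
  proof -
    have "continuous_on UNIV (\<lambda>s. h (w s))"
      using w_range by (intro continuous_on_compose2[OF that cont_w]) auto
    then show ?thesis
      by (simp add: continuous_on_eq_continuous_at)
  qed
  \<comment> \<open>\<open>S\<close> jumps at the kinks but is bounded, so a continuous factor that
    vanishes there forces the limit \<open>0\<close>.\<close>
  have vanish: "((\<lambda>s. S s * h (w s)) \<longlongrightarrow> 0) (at t)"
    if "continuous_on {a..b} h" "h (w t) = 0" for h :: "real \<Rightarrow> real" and t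
  proof (rule Lim_null_comparison)
    show "\<forall>\<^sub>F s in at t. norm (S s * h (w s)) \<le> \<bar>h (w s)\<bar>"
      by (intro always_eventually allI) (auto simp: S_def abs_mult sgn_if)
    show "((\<lambda>s. \<bar>h (w s)\<bar>) \<longlongrightarrow> 0) (at t)"
      using tendsto_rabs[OF cont_comp[OF that(1), of t, unfolded isCont_def]] that(2) by simp
  qed
  have nonsing: "\<forall>\<^sub>F s in at t. sin (pi * s / T) \<noteq> 0" for t
    using T by (rule eventually_sin_nonzero)
  have gap0: "gap (w t) = 0" if "sin (pi * t / T) = 0" for t
    using S0(1)[OF that] gap_ends by metis
  have dw: "(w has_real_derivative S t * speed (w t)) (at t)" for t
  proof (cases "sin (pi * t / T) = 0")
    case True
    have "continuous_on {a..b} speed"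
      using cont_speed[of "{a..b}" "\<lambda>x. x"] by simp
    then have "((\<lambda>s. S s * speed (w s)) \<longlongrightarrow> 0) (at t)"
      by (rule vanish) (simp add: speed_def gap0 True)
    moreover have "\<forall>\<^sub>F s in at t. (w has_real_derivative S s * speed (w s)) (at s)"
      using nonsing by eventually_elim (rule smooth)
    ultimately show ?thesis
      using cont_w S0(2)[OF True] has_real_derivative_from_limit[where f = w and a = t]
      by (simp add: continuous_on_eq_continuous_at)
  qed (rule smooth)
  have d\<Phi>: "(\<Phi> has_real_derivative - deriv V (w t)) (at t)" for t
  proof (cases "sin (pi * t / T) = 0")
    case True
    show ?thesis
    proof (rule has_real_derivative_from_limit)
      have "continuous_on {a..b} (\<lambda>x. gap x powr (1 / conj_exp p))"
        using conj_exp_pos[OF p]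
        by (intro continuous_on_powr' continuous_intros) (auto intro!: gap_nonneg)
      then have "(\<Phi> \<longlongrightarrow> 0) (at t)"
        unfolding \<Phi>_def by (rule vanish) (simp add: gap0 True)
      then show "isCont \<Phi> t"
        using S0(2)[OF True] by (simp add: isCont_def \<Phi>_def)
      show "\<forall>\<^sub>F s in at t. (\<Phi> has_real_derivative - deriv V (w s)) (at s)"
        using nonsing by eventually_elim (rule smooth)
      have "continuous_on {a..b} (\<lambda>x. - deriv V x)"
        using cont_V' by (intro continuous_intros) (auto intro: continuous_on_subset)
      then show "((\<lambda>s. - deriv V (w s)) \<longlongrightarrow> - deriv V (w t)) (at t)"
        using cont_comp[of "\<lambda>x. - deriv V x" t] by (simp add: isCont_def)
    qed
  qed (rule smooth)
  have deriv_w: "deriv w t = S t * speed (w t)" for t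
    using dw by (rule DERIV_imp_deriv)
  have speed_nn: "0 \<le> speed x" for x
    by (simp add: speed_def)
  \<comment> \<open>At a kink \<open>S\<close> is \<open>0\<close>, yet the identity survives
    because the speed is \<open>0\<close> there too.\<close>
  have abs_S: "\<bar>S t\<bar> * speed (w t) = speed (w t)" for t
    using gap0[of t] by (cases "sin (pi * t / T) = 0") (auto simp: S_def sgn_if speed_def)
  show thesis
  proof
    have "\<bar>deriv w t\<bar> powr (p - 2) * deriv w t = \<Phi> t" for t
    proof -
      have "\<bar>deriv w t\<bar> = speed (w t)"
        using abs_S[of t] speed_nn[of "w t"] by (simp add: deriv_w abs_mult)
      moreover have "speed (w t) powr (p - 2) * speed (w t) = speed (w t) powr (p - 1)"
        using speed_nn[of "w t"] powr_mult_base[of "speed (w t)" "p - 2"] by (simp add: mult.commute)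
      moreover have "speed (w t) powr (p - 1) = gap (w t) powr (1 / conj_exp p)"
        using p by (simp add: speed_def powr_powr inverse_conj_exp diff_divide_distrib)
      ultimately show ?thesis
        by (simp add: \<Phi>_def deriv_w algebra_simps)
    qed
    then show "plap_solution p V w"
      using dw d\<Phi> by (auto simp: plap_solution_def differentiable_on_def real_differentiable_def)
    show "energy p V w t = E" for t
    proof -
      have "\<bar>deriv w t\<bar> = speed (w t)"
        using abs_S[of t] speed_nn[of "w t"] by (simp add: deriv_w abs_mult)
      then have "\<bar>deriv w t\<bar> powr p = gap (w t)"
        using p gap_nonneg[OF w_range] by (simp add: speed_def powr_powr)
      then show ?thesis
        using conj_exp_pos[OF p] by (simp add: energy_def gap_def)
    qed
    show "range w = {a..b}"
    proof
      show "range w \<subseteq> {a..b}"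
        using w_range by blast
      show "{a..b} \<subseteq> range w"
      proof
        fix x assume x: "x \<in> {a..b}"
        \<comment> \<open>On \<open>{0..T}\<close> the wave is the identity, so \<open>w\<close>
          reaches \<open>x\<close> at time \<open>travel x\<close>.\<close>
        have "travel x \<in> {0..T}"
          using travel_range[OF x] by (simp add: T_def)
        then have "0 \<le> pi * travel x / T" "pi * travel x / T \<le> pi"
          using T by (auto simp: field_simps)
        then have "d (travel x) = travel x"
          using T by (simp add: d_def arccos_cos)
        then show "x \<in> range w"
          using u(3)[OF x] by (metis rangeI w_def)
      qed
    qed
  qed
qed

text \<open>The definite description is resolved by one existing solution: every competitor has
  range \<open>{a..b}\<close>, as the turning points are unique, hence the same minimal period, and
  a function has at most one.\<close>

lemma orbit_period_eq:
  assumes "0 < a" and tp: "turning_points V A B E a b"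
    and uniq: "\<And>w1 w2. turning_points V A B E w1 w2 \<Longrightarrow> w1 = a \<and> w2 = b"
  shows "orbit_period p V A B E = 2 * travel b"
  unfolding orbit_period_def
proof (rule the_equality)
  obtain w where w: "plap_solution p V w" "\<And>t. energy p V w t = E" "range w = {a..b}"
    using solution_exists by blast
  have "0 < w t" for t
    using w(3) \<open>0 < a\<close> by (metis atLeastAtMost_iff less_le_trans rangeI)
  with w tp have "oscillating_solution p V A B E w"
    unfolding oscillating_solution_def by blast
  with solution_minimal_period[OF w]
  show "\<exists>w. oscillating_solution p V A B E w \<and> is_minimal_period w (2 * travel b)"
    by blast
  fix T assume "\<exists>w. oscillating_solution p V A B E w \<and> is_minimal_period w T"
  then obtain w where w: "oscillating_solution p V A B E w" "is_minimal_period w T"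
    by blast
  have "range w = {a..b}"
    using w(1) uniq unfolding oscillating_solution_def by metis
  then have "is_minimal_period w (2 * travel b)"
    using w(1) unfolding oscillating_solution_def by (intro solution_minimal_period) auto
  with w(2) show "T = 2 * travel b"
    unfolding is_minimal_period_def by (meson linorder_neqE_linordered_idom)
qed

end

section \<open>Dependence of the travel time on the energy\<close>

text \<open>The derivative of the quotient is
  \<open>f powr (1 / q - 1) / q * (f'\<^sup>2 - q f f'')\<close> over \<open>f'\<^sup>2\<close>, so
  \<open>cond\<close> is precisely its positivity.\<close>

lemma powr_div_deriv_increasing:
  fixes f f' f'' :: "real \<Rightarrow> real"
  assumes "0 < q" "x < y"
    and df: "\<And>z. x \<le> z \<Longrightarrow> z \<le> y \<Longrightarrow> (f has_real_derivative f' z) (at z)"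
    and ddf: "\<And>z. x \<le> z \<Longrightarrow> z \<le> y \<Longrightarrow> (f' has_real_derivative f'' z) (at z)"
    and pos: "\<And>z. x \<le> z \<Longrightarrow> z \<le> y \<Longrightarrow> 0 < f z \<and> 0 < f' z"
    and cond: "\<And>z. x \<le> z \<Longrightarrow> z \<le> y \<Longrightarrow> 0 < (f' z)\<^sup>2 - q * f z * f'' z"
  shows "f x powr (1 / q) / f' x < f y powr (1 / q) / f' y"
proof (rule DERIV_pos_imp_increasing[OF \<open>x < y\<close>])
  fix z assume z: "x \<le> z" "z \<le> y"
  let ?D = "1 / q * f z powr (1 / q - 1) * f' z"
  have "((\<lambda>z. f z powr (1 / q)) has_real_derivative ?D) (at z)"
    by (rule DERIV_chain2[where f = "\<lambda>z. z powr (1 / q)" and g = f,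
          OF has_real_derivative_powr df[OF z]]) (use pos z in simp)
  from DERIV_divide[OF this ddf[OF z]]
  have "((\<lambda>z. f z powr (1 / q) / f' z) has_real_derivative
      (?D * f' z - f z powr (1 / q) * f'' z) / (f' z * f' z)) (at z)"
    using pos[OF z] by simp
  moreover have "?D * f' z - f z powr (1 / q) * f'' z =
      f z powr (1 / q - 1) / q * ((f' z)\<^sup>2 - q * f z * f'' z)"
    using \<open>0 < q\<close> pos[OF z] powr_mult_base[of "f z" "1 / q - 1"]
    by (simp add: field_simps power2_eq_square)
  moreover have "0 < f z powr (1 / q - 1) / q * ((f' z)\<^sup>2 - q * f z * f'' z)"
    using \<open>0 < q\<close> pos[OF z] cond[OF z] by simp
  ultimately show "\<exists>D. ((\<lambda>z. f z powr (1 / q) / f' z) has_real_derivative D) (at z) \<and> 0 < D"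
    using pos[OF z] by (metis divide_pos_pos mult_pos_pos)
qed

text \<open>
  The substitution \<open>V x = E s\<close> turns the travel time over a monotone branch into an
  integral over \<open>0 < s < 1\<close> with integrand \<open>K s * V x powr (1 / p') / V' x\<close>, whose kernel
  \<open>K\<close> does not depend on \<open>E\<close>.
\<close>

lemma branch_time_increasing:
  fixes p A B E1 E2 b1 b2 :: real and V V' V'' F1 F2 :: "real \<Rightarrow> real"
  assumes p: "1 < p" and AB: "A < B"
    and contV: "continuous_on {A..B} V"
    and dV: "\<And>x. A < x \<Longrightarrow> x < B \<Longrightarrow> (V has_real_derivative V' x) (at x)"
    and ddV: "\<And>x. A < x \<Longrightarrow> x < B \<Longrightarrow> (V' has_real_derivative V'' x) (at x)"
    and VA: "V A = 0"
    and V'_pos: "\<And>x. A < x \<Longrightarrow> x < B \<Longrightarrow> 0 < V' x"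
    and cond: "\<And>x. A < x \<Longrightarrow> x < B \<Longrightarrow> 0 < (V' x)\<^sup>2 - conj_exp p * V x * V'' x"
    and E: "0 < E1" "E1 < E2"
    and b: "A < b1" "b1 < B" "V b1 = E1" "A < b2" "b2 < B" "V b2 = E2"
    and F1: "continuous_on {A..b1} F1" "\<And>x. A < x \<Longrightarrow> x < b1 \<Longrightarrow>
      (F1 has_real_derivative 1 / (conj_exp p * (E1 - V x)) powr (1 / p)) (at x)"
    and F2: "continuous_on {A..b2} F2" "\<And>x. A < x \<Longrightarrow> x < b2 \<Longrightarrow>
      (F2 has_real_derivative 1 / (conj_exp p * (E2 - V x)) powr (1 / p)) (at x)"
  shows "F1 b1 - F1 A < F2 b2 - F2 A"
proof -
  define q where "q = conj_exp p"
  have q: "0 < q" "1 / q = 1 - 1 / p"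
    using conj_exp_pos[OF p] inverse_conj_exp[OF p] by (simp_all add: q_def)
  have monoV: "strict_mono_on {A..B} V"
    using contV dV V'_pos by (rule strict_mono_on_deriv_pos)
  have V_pos: "0 < V x" if "A < x" "x < B" for x
    using strict_mono_onD[OF monoV, of A x] that VA by simp
  \<comment> \<open>\<open>v\<close> inverts \<open>V\<close> on the branch, so
    \<open>v (E * s)\<close> is the position where the potential is the fraction \<open>s\<close> of
    \<open>E\<close>.\<close>
  obtain v where v0: "continuous_on {0..V B} v" "strict_mono_on {0..V B} v"
    "\<forall>x\<in>{A..B}. v (V x) = x"
    "\<forall>y\<in>{0..V B}. v y \<in> {A..B} \<and> V (v y) = y"
    "\<forall>y. 0 < y \<longrightarrow> y < V B \<longrightarrow> A < v y \<and> v y < B \<and>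
       (v has_real_derivative inverse (V' (v y))) (at y)"
    by (rule increasing_inverse[OF AB contV dV V'_pos, unfolded VA])
  note v = v0[rule_format]
  \<comment> \<open>At \<open>x = v (E * s)\<close> the difference \<open>E - V x\<close> is
    \<open>E * (1 - s)\<close>, and \<open>dx\<close> is \<open>E / V' x\<close> times
    \<open>ds\<close>. The powers of \<open>E\<close> combine to \<open>E powr (1 / q)\<close>,
    which is \<open>V x powr (1 / q) / s powr (1 / q)\<close>; this separates \<open>G\<close> from
    \<open>K\<close>.\<close>
  define G where "G x = V x powr (1 / q) / V' x" for x
  define K where "K s = 1 / ((q * (1 - s)) powr (1 / p) * s powr (1 / q))" for s
  have branch: "continuous_on {0..1} (\<lambda>s. F (v (E * s)))"
    "F (v (E * 1)) = F b" "F (v (E * 0)) = F A"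
    "\<And>s. 0 < s \<Longrightarrow> s < 1 \<Longrightarrow>
      ((\<lambda>s. F (v (E * s))) has_real_derivative K s * G (v (E * s))) (at s)"
    "E < V B"
    if E: "0 < E" and b: "A < b" "b < B" "V b = E"
      and F: "continuous_on {A..b} F" "\<And>x. A < x \<Longrightarrow> x < b \<Longrightarrow>
        (F has_real_derivative 1 / (conj_exp p * (E - V x)) powr (1 / p)) (at x)"
    for E b F
  proof -
    show EB: "E < V B"
      using strict_mono_onD[OF monoV, of b B] b by simp
    have ends: "v E = b" "v 0 = A"
      using v(3)[of b] v(3)[of A] b AB VA by simp_all
    then show "F (v (E * 1)) = F b" "F (v (E * 0)) = F A"
      by simp_all
    have Es: "0 \<le> E * s" "E * s \<le> E" if "s \<in> {0..1}" for s
      using that E by (auto simp: mult_left_le)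
    have "v (E * s) \<in> {A..b}" if "s \<in> {0..1}" for s
      using strict_mono_on_leD[OF v(2), of 0 "E * s"] strict_mono_on_leD[OF v(2), of "E * s" E]
        Es[OF that] EB E ends by auto
    moreover have "continuous_on {0..1} (\<lambda>s. v (E * s))"
    proof (rule continuous_on_compose2[OF v(1)])
      show "(\<lambda>s. E * s) ` {0..1} \<subseteq> {0..V B}"
        using Es EB by force
    qed (intro continuous_intros)
    ultimately show "continuous_on {0..1} (\<lambda>s. F (v (E * s)))"
      by (intro continuous_on_compose2[OF F(1)]) auto
    fix s :: real assume s: "0 < s" "s < 1"
    define x where "x = v (E * s)"
    have y: "0 < E * s" "E * s < E"
      using s E by auto
    then have y': "E * s < V B"
      using EB by simp
    have x: "A < x" "x < B" "V x = E * s" and dv: "(v has_real_derivative inverse (V' x)) (at (E * s))"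
      using v(4)[of "E * s"] v(5)[of "E * s"] y y' by (auto simp: x_def)
    have "x < b"
      using strict_mono_onD[OF v(2), of "E * s" E] y EB ends by (simp add: x_def)
    have "((\<lambda>s. v (E * s)) has_real_derivative inverse (V' x) * E) (at s)"
      by (rule DERIV_chain2[where f = v and g = "\<lambda>s. E * s", OF dv]) (auto intro!: derivative_eq_intros)
    from DERIV_chain2[where f = F and g = "\<lambda>s. v (E * s)", OF F(2)[of "v (E * s)"] this]
    have "((\<lambda>s. F (v (E * s))) has_real_derivative
        1 / (q * (E - V x)) powr (1 / p) * (inverse (V' x) * E)) (at s)"
      using x \<open>x < b\<close> by (simp add: x_def q_def)
    moreover have "1 / (q * (E - V x)) powr (1 / p) * (inverse (V' x) * E) = K s * G x"
    proof -
      have "(q * (E - V x)) powr (1 / p) = E powr (1 / p) * (q * (1 - s)) powr (1 / p)"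
        using E s q by (subst powr_mult[symmetric]) (auto simp: x algebra_simps)
      moreover have "E = E powr (1 / p) * E powr (1 / q)"
        using E q by (simp add: powr_add[symmetric])
      moreover have "V x powr (1 / q) = E powr (1 / q) * s powr (1 / q)"
        using E s by (simp add: x powr_mult)
      moreover have "0 < E powr (1 / p)" "0 < s powr (1 / q)" "0 < (q * (1 - s)) powr (1 / p)"
        using E s q by auto
      ultimately show ?thesis
        using V'_pos[OF x(1,2)] unfolding G_def K_def
        by (simp add: field_simps)
    qed
    ultimately show "((\<lambda>s. F (v (E * s))) has_real_derivative K s * G (v (E * s))) (at s)"
      by (simp add: x_def)
  qed
  have "0 < E2"
    using E by simp
  note h1 = branch[OF E(1) b(1-3) F1]
  note h2 = branch[OF \<open>0 < E2\<close> b(4-6) F2]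
  \<comment> \<open>Working with the difference of primitives avoids comparing improper integrals:
    its values at \<open>0\<close> and \<open>1\<close> give the claim. Its slope is positive
    because the higher energy puts \<open>v (E2 * s)\<close> farther from \<open>A\<close>, where
    \<open>G\<close> is larger.\<close>
  have "strict_mono_on {0..1} (\<lambda>s. F2 (v (E2 * s)) - F1 (v (E1 * s)))"
  proof (rule strict_mono_on_deriv_pos)
    show "continuous_on {0..1} (\<lambda>s. F2 (v (E2 * s)) - F1 (v (E1 * s)))"
      by (intro continuous_on_diff h1 h2)
    fix s :: real assume s: "0 < s" "s < 1"
    show "((\<lambda>s. F2 (v (E2 * s)) - F1 (v (E1 * s))) has_real_derivative
        K s * G (v (E2 * s)) - K s * G (v (E1 * s))) (at s)"
      by (intro DERIV_diff h1 h2 s)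
    have "E2 * s < E2"
      using s E by simp
    then have "E2 * s < V B"
      using h2(5) by (rule less_trans)
    moreover have "0 < E1 * s" "E1 * s < E2 * s"
      using s E by auto
    ultimately have y: "0 < E1 * s" "E1 * s < E2 * s" "E2 * s < V B"
      by blast+
    have x: "A < v (E1 * s)" "v (E2 * s) < B"
      using v(5)[of "E1 * s"] v(5)[of "E2 * s"] y by auto
    moreover have "v (E1 * s) < v (E2 * s)"
      using strict_mono_onD[OF v(2), of "E1 * s" "E2 * s"] y by auto
    ultimately have "G (v (E1 * s)) < G (v (E2 * s))"
      unfolding G_def using q(1) dV ddV V_pos V'_pos cond
      by (intro powr_div_deriv_increasing[where f'' = V'']) (auto simp: q_def)
    moreover have "0 < K s"
      using s q by (simp add: K_def)
    ultimately show "0 < K s * G (v (E2 * s)) - K s * G (v (E1 * s))"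
      by simp
  qed
  from strict_mono_onD[OF this, of 0 1] show ?thesis
    using h1(2,3) h2(2,3) by simp
qed

section \<open>Turning points at each energy and comparison of the two branches\<close>

theorem theorem1p1:
  fixes p A B Estar :: real and V :: "real \<Rightarrow> real"
  assumes p: "p > 2"
    and V_C2: "V differentiable_on UNIV" "deriv V differentiable_on UNIV"
      "continuous_on UNIV (deriv (deriv V))"
    and AB: "0 < A" "A < B"
    and Estar: "Estar > 0"
    and V_ends: "V 0 = Estar" "V B = Estar"
    and V_crit: "deriv V 0 = 0" "V A = 0" "deriv V A = 0" "deriv (deriv V) A > 0"
    and V_range: "\<And>w. w \<in> {0<..<A} \<union> {A<..<B} \<Longrightarrow> 0 < V w \<and> V w < Estar"
    and V_mono: "\<And>w. w \<in> {0<..<A} \<union> {A<..<B} \<Longrightarrow> (w - A) * deriv V w > 0"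
    and V_cond: "\<And>w. w \<in> {0<..<A} \<union> {A<..<B} \<Longrightarrow>
      \<bar>deriv V w\<bar>\<^sup>2 - conj_exp p * V w * deriv (deriv V) w > 0"
  shows "strict_mono_on {0<..<Estar} (\<lambda>E. orbit_period p V A B E)"
proof -
  have p1: "1 < p"
    using p by simp
  have dV: "(V has_real_derivative deriv V x) (at x)" for x
    using V_C2(1) by (simp add: differentiable_on_def DERIV_deriv_iff_real_differentiable)
  have ddV: "(deriv V has_real_derivative deriv (deriv V) x) (at x)" for x
    using V_C2(2) by (simp add: differentiable_on_def DERIV_deriv_iff_real_differentiable)
  have contV: "continuous_on S V" and contV': "continuous_on S (deriv V)" for S
    using differentiable_imp_continuous_on[OF V_C2(1)] differentiable_imp_continuous_on[OF V_C2(2)]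
    by (auto intro: continuous_on_subset)
  have left: "deriv V x < 0" if "0 < x" "x < A" for x
    using V_mono[of x] that by (auto simp: zero_less_mult_iff)
  have right: "0 < deriv V x" if "A < x" "x < B" for x
    using V_mono[of x] that by (auto simp: zero_less_mult_iff)
  have V_up: "strict_mono_on {A..B} V"
    using contV dV right by (rule strict_mono_on_deriv_pos)
  have "((\<lambda>x. - V x) has_real_derivative - deriv V x) (at x)" for x
    using dV by (rule DERIV_minus)
  then have V_down: "strict_mono_on {0..A} (\<lambda>x. - V x)"
    using left by (intro strict_mono_on_deriv_pos[where f' = "\<lambda>x. - deriv V x"] continuous_on_minus contV) auto
  \<comment> \<open>The intermediate value theorem gives a point at level \<open>E\<close> on each
    side of \<open>A\<close>, unique by strict monotonicity. As \<open>0 < E < Estar\<close>, these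
    points lie in the open intervals where \<open>V'\<close> has a strict sign, so they are
    nondegenerate turning points.\<close>
  have well: "\<exists>a b. 0 < a \<and> a < A \<and> A < b \<and> b < B \<and> V a = E \<and> V b = E \<and> potential_well p E a b V \<and>
      orbit_period p V A B E = 2 * potential_well.travel p E a V b"
    if E: "0 < E" "E < Estar" for E
  proof -
    obtain a where a: "0 \<le> a" "a \<le> A" "V a = E"
      using IVT2'[of V A E 0] contV E AB V_ends V_crit by (auto intro: less_imp_le)
    obtain b where b: "A \<le> b" "b \<le> B" "V b = E"
      using IVT'[of V A E B] contV E AB V_ends V_crit by (auto intro: less_imp_le)
    have ab: "0 < a" "a < A" "A < b" "b < B"
      using a b E V_ends V_crit by (auto simp: less_le)
    have V_less: "V x < E" if x: "a < x" "x < b" for x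
    proof (cases "x \<le> A")
      case True
      then show ?thesis
        using strict_mono_onD[OF V_down, of a x] x ab a by auto
    next
      case False
      then show ?thesis
        using strict_mono_onD[OF V_up, of x b] x ab b by auto
    qed
    interpret W: potential_well p E a b V
      using p1 ab V_C2(1) contV' a b V_less left[of a] right[of b] by unfold_locales auto
    have "orbit_period p V A B E = 2 * W.travel b"
    proof (rule W.orbit_period_eq)
      show "turning_points V A B E a b"
        using ab a b V_less by (auto simp: turning_points_def)
      show "w1 = a \<and> w2 = b" if "turning_points V A B E w1 w2" for w1 w2
        using that ab a b inj_onD[OF strict_mono_on_imp_inj_on[OF V_down], of w1 a]
          inj_onD[OF strict_mono_on_imp_inj_on[OF V_up], of w2 b]
        by (auto simp: turning_points_def)
    qed (rule ab)
    then show ?thesis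
      using ab a b W.potential_well_axioms by blast
  qed
  show ?thesis
  proof (rule strict_mono_onI)
    fix E1 E2 assume "E1 \<in> {0<..<Estar}" "E2 \<in> {0<..<Estar}" "E1 < E2"
    then have E: "0 < E1" "E1 < E2" "0 < E2" "E1 < Estar" "E2 < Estar"
      by auto
    obtain a1 b1 where 1: "0 < a1" "a1 < A" "A < b1" "b1 < B" "V a1 = E1" "V b1 = E1"
      "potential_well p E1 a1 b1 V" "orbit_period p V A B E1 = 2 * potential_well.travel p E1 a1 V b1"
      using well[OF E(1,4)] by blast
    obtain a2 b2 where 2: "0 < a2" "a2 < A" "A < b2" "b2 < B" "V a2 = E2" "V b2 = E2"
      "potential_well p E2 a2 b2 V" "orbit_period p V A B E2 = 2 * potential_well.travel p E2 a2 V b2"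
      using well[OF E(3,5)] by blast
    interpret W1: potential_well p E1 a1 b1 V
      by (rule 1)
    interpret W2: potential_well p E2 a2 b2 V
      by (rule 2)
    have "W1.travel b1 - W1.travel A < W2.travel b2 - W2.travel A"
    proof (rule branch_time_increasing[OF p1 AB(2) contV dV ddV V_crit(2) right])
      show "continuous_on {A..b1} W1.travel" "continuous_on {A..b2} W2.travel"
        using W1.cont_travel W2.cont_travel 1 2 by (auto intro: continuous_on_subset)
      show "(W1.travel has_real_derivative 1 / (conj_exp p * (E1 - V x)) powr (1 / p)) (at x)"
        if "A < x" "x < b1" for x
        using W1.travel_deriv[of x] that 1 by (simp add: W1.speed_def W1.gap_def)
      show "(W2.travel has_real_derivative 1 / (conj_exp p * (E2 - V x)) powr (1 / p)) (at x)"
        if "A < x" "x < b2" for x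
        using W2.travel_deriv[of x] that 2 by (simp add: W2.speed_def W2.gap_def)
      show "0 < (deriv V x)\<^sup>2 - conj_exp p * V x * deriv (deriv V) x" if "A < x" "x < B" for x
        using V_cond[of x] that by simp
    qed (use E 1 2 in auto)
    \<comment> \<open>Reflection at \<open>0\<close> makes the left branch increasing on
      \<open>{- A..0}\<close>, with \<open>- travel (- x)\<close> as a primitive of the reflected
      slowness. The double negations fit the lemma's form and reduce to the time from the left
      turning point to \<open>A\<close>.\<close>
    moreover have "- W1.travel (- (- a1)) - - W1.travel (- (- A)) < - W2.travel (- (- a2)) - - W2.travel (- (- A))"
    proof (rule branch_time_increasing[where A = "- A" and B = 0 and V = "\<lambda>x. V (- x)" and ?E1.0 = E1 and ?E2.0 = E2
          and V' = "\<lambda>x. - deriv V (- x)" and V'' = "\<lambda>x. deriv (deriv V) (- x)"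
          and ?F1.0 = "\<lambda>x. - W1.travel (- x)" and ?F2.0 = "\<lambda>x. - W2.travel (- x)", OF p1])
      show "continuous_on {- A..0} (\<lambda>x. V (- x))"
        by (intro continuous_on_compose2[OF contV[of UNIV]] continuous_intros) auto
      show "((\<lambda>x. V (- x)) has_real_derivative - deriv V (- x)) (at x)" for x
        using dV[of "- x"] by (simp add: DERIV_mirror)
      show "((\<lambda>x. - deriv V (- x)) has_real_derivative deriv (deriv V) (- x)) (at x)" for x
        using DERIV_minus[OF ddV[of "- x", unfolded DERIV_mirror]] by simp
      show "0 < (- deriv V (- x))\<^sup>2 - conj_exp p * V (- x) * deriv (deriv V) (- x)"
        if "- A < x" "x < 0" for x
        using V_cond[of "- x"] that by simp
      show "0 < - deriv V (- x)" if "- A < x" "x < 0" for x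
        using left[of "- x"] that by simp
      show "continuous_on {- A..- a1} (\<lambda>x. - W1.travel (- x))"
        using 1 by (intro continuous_on_minus continuous_on_compose2[OF W1.cont_travel] continuous_intros) auto
      show "continuous_on {- A..- a2} (\<lambda>x. - W2.travel (- x))"
        using 2 by (intro continuous_on_minus continuous_on_compose2[OF W2.cont_travel] continuous_intros) auto
      show "((\<lambda>x. - W1.travel (- x)) has_real_derivative 1 / (conj_exp p * (E1 - V (- x))) powr (1 / p)) (at x)"
        if "- A < x" "x < - a1" for x
        using DERIV_minus[OF W1.travel_deriv[of "- x", unfolded DERIV_mirror]] that 1
        by (simp add: W1.speed_def W1.gap_def)
      show "((\<lambda>x. - W2.travel (- x)) has_real_derivative 1 / (conj_exp p * (E2 - V (- x))) powr (1 / p)) (at x)"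
        if "- A < x" "x < - a2" for x
        using DERIV_minus[OF W2.travel_deriv[of "- x", unfolded DERIV_mirror]] that 2
        by (simp add: W2.speed_def W2.gap_def)
    qed (use E 1 2 AB V_crit in auto)
    \<comment> \<open>\<open>travel\<close> vanishes at the left turning point, so the two branch
      times add up to the half period at each energy.\<close>
    ultimately show "orbit_period p V A B E1 < orbit_period p V A B E2"
      using 1(8) 2(8) by simp
  qed
qed

end
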